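(* Let $f_n$ be the number of $(123,321)$-sortable permutations of length $n$. Then $f_1=1$, $f_2=2$, $f_3=4$, and $$f_n=7\cdot 2^{n-4}\quad\text{for all } n\ge 4.$$
   Context: For a set $\Sigma$ of permutations of length at least $2$, the $\Sigma$-stack acts on an input permutation $\pi=\pi_1\cdots\pi_n$ as follows (starting with empty stack and output). For $i=1,\dots,n$: as long as pushing $\pi_i$ on top of the stack would make the content of the stack, read from top to bottom, contain an occurrence of some $\sigma\in\Sigma$ (a subsequence order isomorphic to $\sigma$), pop the top element and append it to the output; then push $\pi_i$. After all letters have been pushed, pop all remaining elements, from top to bottom, appending them to the output. The resulting output is denoted $\mathcal{S}^{\Sigma}(\pi)$. The permutation $\pi$ of length $n$ is $\Sigma$-sortable if $\mathcal{S}^{21}(\mathcal{S}^{\Sigma}(\pi))=12\cdots n$, where $\mathcal{S}^{21}=\mathcal{S}^{\{21\}}$. For $\Sigma=\{\sigma,\tau\}$ one writes $(\sigma,\tau)$-sortable. *)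

theory Defs
  imports "HOL-Library.Sublist" "HOL-Combinatorics.Multiset_Permutations"
begin

text \<open>
  Permutations are written in one-line notation: a permutation of length \<open>n\<close> is an element of
  \<^term>\<open>permutations_of_set {1..n::nat}\<close>, i.e. a duplicate-free list with entries \<open>1, \<dots>, n\<close>.
\<close>

definition order_isomorphic :: "nat list \<Rightarrow> nat list \<Rightarrow> bool" where
  "order_isomorphic xs ys \<longleftrightarrow>
     length xs = length ys \<and>
     (\<forall>i < length xs. \<forall>j < length xs. xs ! i < xs ! j \<longleftrightarrow> ys ! i < ys ! j)"

definition contains_pattern :: "nat list \<Rightarrow> nat list \<Rightarrow> bool" where
  "contains_pattern xs \<sigma> \<longleftrightarrow> (\<exists>ys. subseq ys xs \<and> order_isomorphic ys \<sigma>)"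

text \<open>
  A state is a pair (stack, output). The stack is listed from top to bottom, so its head is the
  top element; the output is listed in the order in which the letters were appended.
  As all patterns in \<open>\<Sigma>\<close> are meant to have length at least 2, pushing on an empty stack never
  creates a pattern, so no test is needed in that case.
\<close>

fun push_letter :: "nat list set \<Rightarrow> nat \<Rightarrow> nat list \<times> nat list \<Rightarrow> nat list \<times> nat list" where
  "push_letter \<Sigma> x ([], out) = ([x], out)"
| "push_letter \<Sigma> x (s # st, out) =
     (if \<exists>\<sigma>\<in>\<Sigma>. contains_pattern (x # s # st) \<sigma>
      then push_letter \<Sigma> x (st, out @ [s])
      else (x # s # st, out))"

definition stack_map :: "nat list set \<Rightarrow> nat list \<Rightarrow> nat list" where
  "stack_map \<Sigma> \<pi> = (let (st, out) = fold (push_letter \<Sigma>) \<pi> ([], []) in out @ st)"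

definition sortable :: "nat list set \<Rightarrow> nat list \<Rightarrow> bool" where
  "sortable \<Sigma> \<pi> \<longleftrightarrow> stack_map {[2, 1]} (stack_map \<Sigma> \<pi>) = [1..<length \<pi> + 1]"

definition num_sortable :: "nat list set \<Rightarrow> nat \<Rightarrow> nat" where
  "num_sortable \<Sigma> n = card {\<pi> \<in> permutations_of_set {1..n}. sortable \<Sigma> \<pi>}"

end

theory Submission
  imports Defs
begin

text \<open>
  Sortable means that the output of the first stack avoids 231, because the second stack is
  Knuth's stack (\<open>sortable_iff_avoids_231\<close>). It remains to see which outputs of the
  (123,321)-stack avoid 231.

  The first letter \<open>a\<close> of the permutation stays at the bottom of the stack for ever. As long as
  only letters smaller than \<open>a\<close> arrive, the stack above \<open>a\<close> consists of the current minimum \<open>m\<close>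
  and at most one letter on top of it: a letter above \<open>m\<close> is expelled by whatever comes next,
  and \<open>m\<close> is expelled by the next smaller letter. So the small letters leave in their original
  order, except that each left-to-right minimum is held back until the next one arrives. Such a
  rearrangement ends with its minimum; hence it avoids 231 only if it is decreasing, any ascent
  together with the final minimum being a 231.

  Letters larger than \<open>a\<close> leave little room. Any two of them lead to a 231 in the output, and
  a single one, \<open>b\<close>, can only be in second position, or in third position after some \<open>m < a\<close>
  and not directly before a letter larger than \<open>m\<close> (\<open>large_letters\<close>). In the last case the
  output is \<open>b\<close>, \<open>m\<close>, the rearrangement of the remaining letters, and \<open>a\<close>; the final minimum
  of this rearrangement again forces everything before \<open>a\<close> to be decreasing, so that
  \<open>m\<close> is larger than all the remaining letters.
  Therefore a sortable permutation of length \<open>n\<close> is one of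
  \<open>n # xs\<close>, \<open>(n - 1) # n # xs\<close> and \<open>(n - 1) # (n - 2) # n # xs\<close>, where \<open>xs\<close> is a
  permutation whose rearrangement is decreasing, and conversely (\<open>sortable_iff\<close>).

  In a list of the kind \<open>xs\<close> the maximum is first or second, and deleting it leaves a list of the
  same kind. There are thus \<open>2 ^ (k - 1)\<close> of them for each length \<open>k \<ge> 1\<close>, and
  \<open>2 ^ (n - 2) + 2 ^ (n - 3) + 2 ^ (n - 4) = 7 * 2 ^ (n - 4)\<close>.
\<close>

section \<open>Passing through the 21-avoiding stack\<close>

definition avoids_231 :: "nat list \<Rightarrow> bool" where
  "avoids_231 xs \<longleftrightarrow> (\<forall>p q r. subseq [p, q, r] xs \<longrightarrow> \<not> (r < p \<and> p < q))"

lemma avoids_231_subseq: "avoids_231 ys \<Longrightarrow> subseq xs ys \<Longrightarrow> avoids_231 xs"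
  unfolding avoids_231_def using subseq_order.order_trans by blast

lemma subseq_Cons_iff:
  "subseq (z # zs) (x # xs) \<longleftrightarrow> subseq (z # zs) xs \<or> (z = x \<and> subseq zs xs)"
  by (auto dest: subseq_Cons')

lemma subseq_snoc_iff:
  "subseq (zs @ [r]) (xs @ [x]) \<longleftrightarrow> subseq (zs @ [r]) xs \<or> (subseq zs xs \<and> r = x)"
proof
  assume "subseq (zs @ [r]) (xs @ [x])"
  then obtain us vs where *: "zs @ [r] = us @ vs" "subseq us xs" "subseq vs [x]"
    by (auto elim: subseq_appendE)
  show "subseq (zs @ [r]) xs \<or> (subseq zs xs \<and> r = x)"
  proof (cases vs rule: rev_cases)
    case (snoc ws w)
    then have "ws = []" using list_emb_length[OF *(3)] by simp
    with snoc * show ?thesis by (auto split: if_splits)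
  qed (use * in auto)
qed (auto intro: subseq_rev_drop_many)

lemmas subseq_pair_snoc_iff = subseq_snoc_iff[of "[p]" for p, simplified]
lemmas subseq_triple_snoc_iff = subseq_snoc_iff[of "[p, q]" for p q, simplified]

lemma mset_push_letter:
  "push_letter \<Sigma> x (st, out) = (st', out') \<Longrightarrow>
     mset (out' @ st') = add_mset x (mset (out @ st))"
  by (induction \<Sigma> x "(st, out)" arbitrary: st out rule: push_letter.induct)
     (auto split: if_splits)

lemma mset_fold_push_letter:
  "fold (push_letter \<Sigma>) xs (st, out) = (st', out') \<Longrightarrow>
     mset (out' @ st') = mset (out @ st @ xs)"
proof (induction xs arbitrary: st out)
  case (Cons x xs)
  obtain st1 out1 where "push_letter \<Sigma> x (st, out) = (st1, out1)" by fastforce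
  with Cons.prems Cons.IH[of st1 out1] mset_push_letter[of \<Sigma> x st out st1 out1]
  show ?case by auto
qed auto

lemma mset_stack_map: "mset (stack_map \<Sigma> xs) = mset xs"
  using mset_fold_push_letter[of \<Sigma> xs "[]" "[]"]
  by (auto simp: stack_map_def split: prod.splits)

lemma set_stack_map: "set (stack_map \<Sigma> xs) = set xs"
  using mset_stack_map mset_eq_setD by blast

lemma distinct_stack_map: "distinct (stack_map \<Sigma> xs) = distinct xs"
  using mset_stack_map mset_eq_imp_distinct_iff by blast

text \<open>
  Output followed by stack only ever gains letters: popping moves a letter across the border
  between the two, pushing inserts one at this border. A pattern seen halfway through the
  process is therefore present in the final output.
\<close>
lemma subseq_push_letter:
  "push_letter \<Sigma> x (st, out) = (st', out') \<Longrightarrow> subseq (out @ st) (out' @ st')"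
proof (induction \<Sigma> x "(st, out)" arbitrary: st out rule: push_letter.induct)
  case (2 \<Sigma> x s st out)
  show ?case
  proof (cases "\<exists>\<sigma>\<in>\<Sigma>. contains_pattern (x # s # st) \<sigma>")
    case True
    with 2 show ?thesis by auto
  next
    case False
    with 2 show ?thesis by (auto intro!: list_emb_append_mono)
  qed
qed auto

lemma subseq_fold_push_letter:
  "fold (push_letter \<Sigma>) xs (st, out) = (st', out') \<Longrightarrow> subseq (out @ st) (out' @ st')"
proof (induction xs arbitrary: st out)
  case (Cons x xs)
  obtain st1 out1 where "push_letter \<Sigma> x (st, out) = (st1, out1)" by fastforce
  with Cons.prems Cons.IH[of st1 out1] subseq_push_letter[of \<Sigma> x st out st1 out1]
  show ?case using subseq_order.order_trans by auto
qed auto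

lemma contains_21_iff: 
  "contains_pattern xs [2, 1] \<longleftrightarrow> (\<exists>p q. subseq [p, q] xs \<and> q < p)"
proof -
  have "order_isomorphic ys [2, 1] \<longleftrightarrow> (\<exists>p q. ys = [p, q] \<and> q < p)" for ys
    unfolding order_isomorphic_def
    by (cases ys; cases "tl ys"; cases "tl (tl ys)")
       (auto simp: less_Suc_eq all_conj_distrib numeral_2_eq_2)
  then show ?thesis by (auto simp: contains_pattern_def)
qed

lemma sorted_wrt_iff_pairs: "sorted_wrt P xs \<longleftrightarrow> (\<forall>p q. subseq [p, q] xs \<longrightarrow> P p q)"
proof (induction xs)
  case (Cons x xs)
  then show ?case unfolding subseq_Cons_iff subseq_singleton_left by auto
qed auto

lemma contains_21_Cons_sorted:
  assumes "sorted (s # st)"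
  shows "contains_pattern (x # s # st) [2, 1] \<longleftrightarrow> s < x"
proof -
  have "\<not> q < p" if "subseq [p, q] (s # st)" for p q
    using assms that unfolding sorted_wrt_iff_pairs by fastforce
  moreover have "s \<le> q" if "q \<in> set (s # st)" for q
    using that assms by auto
  ultimately have "contains_pattern (x # s # st) [2, 1] \<longleftrightarrow> (\<exists>q \<in> set (s # st). q < x)"
    unfolding contains_21_iff
    by (metis subseq_Cons2_iff subseq_singleton_left)
  with assms show ?thesis by auto
qed

lemma push_letter_21:
  assumes "sorted st"
  shows "push_letter {[2, 1]} x (st, out) =
    (x # dropWhile (\<lambda>s. s < x) st, out @ takeWhile (\<lambda>s. s < x) st)"
  using assms
proof (induction st arbitrary: out)
  case (Cons s st)
  then show ?case using contains_21_Cons_sorted[of s st x] by auto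
qed auto

lemma set_takeWhile_less:
  fixes x :: nat
  assumes "sorted st"
  shows "set (takeWhile (\<lambda>s. s < x) st) = {s \<in> set st. s < x}"
  using assms
proof (induction st)
  case (Cons s st)
  then show ?case by (cases "s < x") (auto dest: order_le_less_trans)
qed simp

lemma set_dropWhile_less:
  fixes x :: nat
  assumes "sorted st"
  shows "set (dropWhile (\<lambda>s. s < x) st) = {s \<in> set st. x \<le> s}"
  using assms
proof (induction st)
  case (Cons s st)
  show ?case
  proof (cases "s < x")
    case True
    with Cons show ?thesis by auto
  next
    case False
    with Cons.prems have "\<forall>t \<in> set (s # st). x \<le> t" by fastforce
    with False show ?thesis by auto
  qed
qed simp

text \<open>
  A letter has left the 21-avoiding stack exactly when a larger letter has arrived after it.
  The output is out of order precisely when a letter smaller than such a departed one arrives even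
  later: the departed letter, the larger one and the late one form a 231.
\<close>
lemma fold_push_letter_21:
  assumes "fold (push_letter {[2, 1]}) xs ([], []) = (st, out)"
  shows "sorted st \<and> set out = {p. \<exists>q. subseq [p, q] xs \<and> p < q} \<and>
    set out \<union> set st = set xs \<and> (sorted (out @ st) \<longleftrightarrow> avoids_231 xs)"
  using assms
proof (induction xs arbitrary: st out rule: rev_induct)
  case Nil
  then show ?case by (auto simp: avoids_231_def)
next
  case (snoc x xs)
  obtain st0 out0 where 0: "fold (push_letter {[2, 1]}) xs ([], []) = (st0, out0)" by fastforce
  from snoc.IH[OF 0] have st0: "sorted st0"
    and out0: "set out0 = {p. \<exists>q. subseq [p, q] xs \<and> p < q}"
    and all0: "set out0 \<union> set st0 = set xs"
    and IH: "sorted (out0 @ st0) \<longleftrightarrow> avoids_231 xs"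
    by auto
  define P Q where "P = takeWhile (\<lambda>s. s < x) st0" and "Q = dropWhile (\<lambda>s. s < x) st0"
  have PQ: "st0 = P @ Q" by (simp add: P_def Q_def)
  have eq: "st = x # Q" "out = out0 @ P"
    using snoc.prems 0 push_letter_21[OF st0] by (auto simp: P_def Q_def)
  have setP: "set P = {s \<in> set st0. s < x}" and setQ: "set Q = {s \<in> set st0. x \<le> s}"
    unfolding P_def Q_def using set_takeWhile_less set_dropWhile_less st0 by auto
  have "sorted Q" using st0 by (simp add: PQ sorted_append)
  then have "sorted st" using setQ eq by simp
  moreover have "set out = {p. \<exists>q. subseq [p, q] (xs @ [x]) \<and> p < q}"
    unfolding subseq_pair_snoc_iff subseq_singleton_left eq set_append setP
    using out0 all0 by blast
  moreover have "set out \<union> set st = set (xs @ [x])"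
    using all0 by (auto simp: eq PQ)
  moreover have "sorted (out @ st) \<longleftrightarrow> sorted (out0 @ st0) \<and> (\<forall>p \<in> set out0. p \<le> x)"
  proof -
    have "\<forall>p \<in> set P. p \<le> x" "\<forall>q \<in> set Q. x \<le> q" using setP setQ by auto
    then show ?thesis unfolding eq PQ sorted_append by auto
  qed
  moreover have "avoids_231 (xs @ [x]) \<longleftrightarrow> avoids_231 xs \<and> (\<forall>p \<in> set out0. p \<le> x)"
    unfolding avoids_231_def subseq_triple_snoc_iff out0 not_less[symmetric] by blast
  ultimately show ?case using IH by blast
qed

lemma sorted_stack_map_21_iff: "sorted (stack_map {[2, 1]} xs) \<longleftrightarrow> avoids_231 xs"
proof -
  obtain st out where *: "fold (push_letter {[2, 1]}) xs ([], []) = (st, out)" by fastforce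
  with fold_push_letter_21[OF *] show ?thesis by (simp add: stack_map_def)
qed

lemma sortable_iff_avoids_231:
  assumes "\<pi> \<in> permutations_of_set {1..n}"
  shows "sortable \<Sigma> \<pi> \<longleftrightarrow> avoids_231 (stack_map \<Sigma> \<pi>)"
proof -
  have \<pi>: "distinct \<pi>" "set \<pi> = {1..n}" "length \<pi> = n"
    using permutations_of_setD[OF assms] length_finite_permutations_of_set[OF assms] by simp_all
  let ?ys = "stack_map {[2, 1]} (stack_map \<Sigma> \<pi>)"
  have "distinct ?ys" "set ?ys = set [1..<length \<pi> + 1]"
    unfolding distinct_stack_map set_stack_map \<pi> using \<pi>(1) by auto
  then have "?ys = [1..<length \<pi> + 1] \<longleftrightarrow> sorted ?ys"
    using sorted_distinct_set_unique by (metis distinct_upt sorted_upt)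
  then show ?thesis unfolding sortable_def sorted_stack_map_21_iff .
qed

section \<open>Small letters above a fixed base\<close>

definition push :: "nat \<Rightarrow> nat list \<times> nat list \<Rightarrow> nat list \<times> nat list" where
  "push = push_letter {[1, 2, 3], [3, 2, 1]}"

text \<open>
  A recursive form of containing 123 or 321, by which the simplifier decides the push test on
  an explicitly given stack from the order of its letters.
\<close>
fun monotone_from :: "nat \<Rightarrow> nat list \<Rightarrow> bool" where
  "monotone_from x [] \<longleftrightarrow> False"
| "monotone_from x (y # ys) \<longleftrightarrow>
     (\<exists>z \<in> set ys. x < y \<and> y < z \<or> z < y \<and> y < x) \<or> monotone_from x ys"

fun has_monotone_triple :: "nat list \<Rightarrow> bool" where
  "has_monotone_triple [] \<longleftrightarrow> False"
| "has_monotone_triple (x # xs) \<longleftrightarrow> monotone_from x xs \<or> has_monotone_triple xs"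

lemma monotone_from_iff:
  "monotone_from x xs \<longleftrightarrow> (\<exists>y z. subseq [y, z] xs \<and> (x < y \<and> y < z \<or> z < y \<and> y < x))"
proof (induction xs)
  case (Cons w xs)
  with Cons show ?case unfolding subseq_Cons_iff subseq_singleton_left by auto
qed auto

lemma has_monotone_triple_iff:
  "has_monotone_triple xs \<longleftrightarrow>
     (\<exists>x y z. subseq [x, y, z] xs \<and> (x < y \<and> y < z \<or> z < y \<and> y < x))"
proof (induction xs)
  case (Cons w xs)
  then show ?case
    unfolding has_monotone_triple.simps monotone_from_iff subseq_Cons_iff[of _ "[_, _]"] by blast
qed auto

lemma order_isomorphic_3_iff:
  "order_isomorphic [x, y, z] [a, b, c] \<longleftrightarrow>
     (x < y \<longleftrightarrow> a < b) \<and> (y < x \<longleftrightarrow> b < a) \<and> (x < z \<longleftrightarrow> a < c) \<and>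
     (z < x \<longleftrightarrow> c < a) \<and> (y < z \<longleftrightarrow> b < c) \<and> (z < y \<longleftrightarrow> c < b)"
  by (simp add: order_isomorphic_def All_less_Suc) blast

lemma order_isomorphic_3E:
  assumes "order_isomorphic ys [a, b, c]"
  obtains x y z where "ys = [x, y, z]"
proof -
  from assms have "length ys = Suc (Suc (Suc 0))" by (simp add: order_isomorphic_def)
  then show ?thesis using that by (auto simp only: length_Suc_conv length_0_conv)
qed

lemma contains_123_or_321_iff:
  "(\<exists>\<sigma> \<in> {[1, 2, 3], [3, 2, 1]}. contains_pattern xs \<sigma>) \<longleftrightarrow> has_monotone_triple xs"
proof -
  have 123: "contains_pattern xs [1, 2, 3] \<longleftrightarrow> (\<exists>x y z. subseq [x, y, z] xs \<and> x < y \<and> y < z)"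
  proof
    assume "contains_pattern xs [1, 2, 3]"
    then obtain ys where ys: "subseq ys xs" "order_isomorphic ys [1, 2, 3]"
      by (auto simp: contains_pattern_def)
    obtain x y z where "ys = [x, y, z]" using order_isomorphic_3E[OF ys(2)] by metis
    with ys show "\<exists>x y z. subseq [x, y, z] xs \<and> x < y \<and> y < z"
      by (auto simp: order_isomorphic_3_iff)
  next
    assume "\<exists>x y z. subseq [x, y, z] xs \<and> x < y \<and> y < z"
    then obtain x y z where xyz: "subseq [x, y, z] xs" "x < y" "y < z" by blast
    then have "order_isomorphic [x, y, z] [1, 2, 3]" by (simp add: order_isomorphic_3_iff)
    with xyz show "contains_pattern xs [1, 2, 3]" unfolding contains_pattern_def by blast
  qed
  have 321: "contains_pattern xs [3, 2, 1] \<longleftrightarrow> (\<exists>x y z. subseq [x, y, z] xs \<and> z < y \<and> y < x)"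
  proof
    assume "contains_pattern xs [3, 2, 1]"
    then obtain ys where ys: "subseq ys xs" "order_isomorphic ys [3, 2, 1]"
      by (auto simp: contains_pattern_def)
    obtain x y z where "ys = [x, y, z]" using order_isomorphic_3E[OF ys(2)] by metis
    with ys show "\<exists>x y z. subseq [x, y, z] xs \<and> z < y \<and> y < x"
      by (auto simp: order_isomorphic_3_iff)
  next
    assume "\<exists>x y z. subseq [x, y, z] xs \<and> z < y \<and> y < x"
    then obtain x y z where xyz: "subseq [x, y, z] xs" "z < y" "y < x" by blast
    then have "order_isomorphic [x, y, z] [3, 2, 1]" by (simp add: order_isomorphic_3_iff)
    with xyz show "contains_pattern xs [3, 2, 1]" unfolding contains_pattern_def by blast
  qed
  have "(\<exists>\<sigma> \<in> {[1, 2, 3], [3, 2, 1]}. contains_pattern xs \<sigma>) \<longleftrightarrow>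
      contains_pattern xs [1, 2, 3] \<or> contains_pattern xs [3, 2, 1]"
    by simp
  then show ?thesis
    unfolding has_monotone_triple_iff 123 321 by blast
qed

lemma push_Nil: "push x ([], out) = ([x], out)"
  by (simp add: push_def)

lemma push_Cons:
  "push x (s # st, out) =
     (if has_monotone_triple (x # s # st) then push x (st, out @ [s]) else (x # s # st, out))"
  unfolding push_def push_letter.simps contains_123_or_321_iff ..

text \<open>
  The word obtained from a state by emptying its stack. All statements about final outputs are
  phrased through this word, so that they do not depend on the shape of the final stack.
\<close>
definition emit :: "nat list \<times> nat list \<Rightarrow> nat list" where
  "emit s = snd s @ fst s"

text \<open>
  The letters \<open>xs\<close> in their order of arrival, except that the running minimum, initially
  \<open>m\<close>, is held back until a smaller letter replaces it or the input ends.
\<close>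
fun postpone :: "nat \<Rightarrow> nat list \<Rightarrow> nat list" where
  "postpone m [] = [m]"
| "postpone m (x # xs) = (if m < x then x # postpone m xs else m # postpone x xs)"

fun postpone_minima :: "nat list \<Rightarrow> nat list" where
  "postpone_minima [] = []"
| "postpone_minima (x # xs) = postpone x xs"

text \<open>
  With minimum \<open>m\<close> directly above the base and at most one letter \<open>y\<close> above \<open>m\<close>, an
  incoming \<open>x > m\<close> expels \<open>y\<close>, because \<open>x\<close>, \<open>y\<close> together with \<open>m\<close> or with \<open>a\<close>
  form a monotone triple; an incoming \<open>x < m\<close> expels \<open>m\<close> as well, because \<open>x < m < a\<close>. A second
  base letter \<open>b > a\<close> on top of \<open>a\<close> changes nothing, since it lies above all letters in question.
  Both stack shapes are treated simultaneously because each can lead to the other.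
\<close>
lemma emit_fold_push_small_aux:
  assumes "bs = [a] \<or> (\<exists>b > a. bs = [b, a])" "\<forall>x \<in> set xs. x < a" "m < a"
  shows "distinct (m # xs) \<Longrightarrow>
      emit (fold push xs (m # bs, out)) = out @ postpone m xs @ bs"
    and "distinct (y # m # xs) \<Longrightarrow> m < y \<Longrightarrow> y < a \<Longrightarrow>
      emit (fold push xs (y # m # bs, out)) = out @ y # postpone m xs @ bs"
  using assms(2,3)
proof (induction xs arbitrary: m y out)
  case Nil
  { case 1 then show ?case by (simp add: emit_def) next
    case 2 then show ?case by (simp add: emit_def) }
next
  case (Cons x xs)
  { case 1
    then have x: "x < a" and xs: "\<forall>x \<in> set xs. x < a" by auto
    show ?case
    proof (cases "m < x")
      case True
      have "push x (m # bs, out) = (x # m # bs, out)"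
        using assms(1) True 1 by (auto simp: push_Cons)
      with True 1 x xs Cons.IH(2)[of x m out] show ?thesis by auto
    next
      case False
      then have "x < m" using 1 by auto
      then have "push x (m # bs, out) = (x # bs, out @ [m])"
        using assms(1) 1 by (auto simp: push_Cons push_Nil)
      with False 1 x xs Cons.IH(1)[of x "out @ [m]"] show ?thesis by auto
    qed
  next
    case 2
    then have x: "x < a" and xs: "\<forall>x \<in> set xs. x < a" by auto
    show ?case
    proof (cases "m < x")
      case True
      have "push x (y # m # bs, out) = (x # m # bs, out @ [y])"
        using assms(1) True 2 x by (auto simp: push_Cons)
      with True 2 x xs Cons.IH(2)[of x m "out @ [y]"] show ?thesis by auto
    next
      case False
      then have "x < m" using 2 by auto
      then have "push x (y # m # bs, out) = (x # bs, out @ [y, m])"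
        using assms(1) 2 by (auto simp: push_Cons push_Nil)
      with False 2 x xs Cons.IH(1)[of x "out @ [y, m]"] show ?thesis by auto
    qed }
qed


lemma emit_fold_push_small:
  assumes "bs = [a] \<or> (\<exists>b > a. bs = [b, a])" "\<forall>x \<in> set xs. x < a" "distinct xs"
  shows "emit (fold push xs (bs, out)) = out @ postpone_minima xs @ bs"
proof (cases xs)
  case Nil
  then show ?thesis by (simp add: emit_def)
next
  case (Cons x ys)
  then have "push x (bs, out) = (x # bs, out)"
    using assms(1,2) by (auto simp: push_Cons)
  with emit_fold_push_small_aux(1)[OF assms(1), of ys x] assms Cons show ?thesis by simp
qed

text \<open>
  Here \<open>b\<close> sits on the minimum \<open>m\<close>, and the first letter of \<open>xs\<close>, being smaller than \<open>m\<close>,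
  expels both of them. From then on the base is \<open>a\<close> alone.
\<close>
lemma emit_fold_push_valley:
  assumes "m < a" "a < b" "\<forall>x \<in> set xs. x < a" "distinct xs" "xs = [] \<or> hd xs < m"
  shows "emit (fold push xs ([b, m, a], [])) = b # m # postpone_minima xs @ [a]"
proof (cases xs)
  case Nil
  then show ?thesis by (simp add: emit_def)
next
  case (Cons x ys)
  then have "push x ([b, m, a], []) = ([x, a], [b, m])"
    using assms by (auto simp: push_Cons)
  with emit_fold_push_small_aux(1)[of "[a]" a ys x "[b, m]"] assms Cons show ?thesis by simp
qed

lemma stack_map_eq_emit: "stack_map {[1, 2, 3], [3, 2, 1]} xs = emit (fold push xs ([], []))"
  by (simp add: stack_map_def push_def emit_def case_prod_beta Let_def)

section \<open>Where the large letters can be\<close>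

lemma mset_emit_push: "mset (emit (push x s)) = add_mset x (mset (emit s))"
  using mset_push_letter[of "{[1, 2, 3], [3, 2, 1]}" x "fst s" "snd s"]
  by (cases "push_letter {[1, 2, 3], [3, 2, 1]} x s") (simp add: emit_def push_def)

lemma set_emit_fold_push: "set (emit (fold push xs s)) = set (emit s) \<union> set xs"
proof (induction xs arbitrary: s)
  case (Cons x xs)
  have "set (emit (push x s)) = insert x (set (emit s))"
    using arg_cong[OF mset_emit_push[of x s], of set_mset] by simp
  with Cons show ?case by simp
qed simp

lemma avoids_231_fold_push:
  assumes "avoids_231 (emit (fold push xs s))"
  shows "avoids_231 (emit s)"
proof -
  obtain st out st' out' where s: "s = (st, out)" "fold push xs s = (st', out')" by fastforce
  then have "subseq (emit s) (emit (fold push xs s))"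
    using subseq_fold_push_letter[of "{[1, 2, 3], [3, 2, 1]}" xs st out st' out']
    by (simp add: emit_def push_def)
  with assms show ?thesis by (rule avoids_231_subseq)
qed

lemma avoids_231D: "avoids_231 xs \<Longrightarrow> subseq [p, q, r] xs \<Longrightarrow> r < p \<Longrightarrow> p < q \<Longrightarrow> False"
  by (auto simp: avoids_231_def)

lemma set_snd_push: "set (snd s) \<subseteq> set (snd (push x s))"
proof -
  have "set out \<subseteq> set (snd (push x (st, out)))" for st out
  proof (induction st arbitrary: out)
    case (Cons y st)
    from Cons.IH[of "out @ [y]"] show ?case by (auto simp: push_Cons)
  qed (simp add: push_Nil)
  then show ?thesis by (cases s) auto
qed

lemma set_snd_fold_push: "set (snd s) \<subseteq> set (snd (fold push xs s))"
proof (induction xs arbitrary: s)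
  case (Cons x xs)
  from set_snd_push[of s x] Cons.IH[of "push x s"] show ?case by auto
qed simp

text \<open>
  The shape of a state in which at least one letter smaller than \<open>a\<close> has been pushed onto the
  base \<open>bs\<close>: the smallest of them lies directly on \<open>bs\<close>, and it is below every letter that
  has been output so far. The last clause is what turns a departed letter into the 2 of a 231.
\<close>
definition settled :: "nat \<Rightarrow> nat list \<Rightarrow> nat list \<times> nat list \<Rightarrow> bool" where
  "settled a bs s \<longleftrightarrow> (\<exists>m < a.
     (fst s = m # bs \<or> (\<exists>y. m < y \<and> y < a \<and> fst s = y # m # bs)) \<and>
     (\<forall>e \<in> set (snd s). m < e))"

lemma settled_push:
  assumes bs: "bs = [a] \<or> (\<exists>b > a. bs = [b, a])"
    and s: "settled a bs s" and x: "x < a" "x \<notin> set (emit s)"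
  shows "settled a bs (push x s)"
proof -
  obtain st out where [simp]: "s = (st, out)" by fastforce
  from s obtain m where m: "m < a" "\<forall>e \<in> set out. m < e"
    and st: "st = m # bs \<or> (\<exists>y. m < y \<and> y < a \<and> st = y # m # bs)"
    by (auto simp: settled_def)
  have "x \<noteq> m" using x st by (auto simp: emit_def)
  then consider "x < m" | "m < x" by linarith
  then show ?thesis
  proof cases
    case 1
    with m(2) have "\<forall>e \<in> set out. x < e" by auto
    with 1 have "\<exists>out'. push x (st, out) = (x # bs, out') \<and> (\<forall>e \<in> set out'. x < e)"
      using bs st m by (auto simp: push_Cons push_Nil)
    with x show ?thesis by (auto simp: settled_def)
  next
    case 2
    then have "\<exists>out'. push x (st, out) = (x # m # bs, out') \<and> (\<forall>e \<in> set out'. m < e)"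
      using bs st m x by (auto simp: push_Cons push_Nil emit_def)
    with x m 2 show ?thesis by (auto simp: settled_def)
  qed
qed

lemma settled_fold_push:
  assumes bs: "bs = [a] \<or> (\<exists>b > a. bs = [b, a])"
  shows "settled a bs s \<Longrightarrow> \<forall>x \<in> set xs. x < a \<Longrightarrow> distinct (emit s @ xs) \<Longrightarrow>
    settled a bs (fold push xs s)"
proof (induction xs arbitrary: s)
  case (Cons x xs)
  have "mset (emit (push x s) @ xs) = mset (emit s @ x # xs)"
    by (simp add: mset_emit_push)
  then have "distinct (emit (push x s) @ xs)"
    using Cons.prems(3) mset_eq_imp_distinct_iff by blast
  moreover have "settled a bs (push x s)"
    using settled_push[OF bs Cons.prems(1)] Cons.prems by auto
  ultimately show ?case using Cons by simp
qed simp

lemma split_at_first_large: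
  fixes a :: nat
  assumes "\<not> (\<forall>x \<in> set xs. x < a)" "a \<notin> set xs"
  shows "\<exists>ys b zs. xs = ys @ b # zs \<and> (\<forall>y \<in> set ys. y < a) \<and> a < b"
proof -
  from assms(1) obtain ys b zs where "xs = ys @ b # zs" "\<not> b < a" "\<forall>y \<in> set ys. y < a"
    using split_list_first_prop[of xs "\<lambda>x. \<not> x < a"] by blast
  with assms(2) show ?thesis by (metis in_set_conv_decomp linorder_neqE_nat)
qed

text \<open>
  At the arrival of a second large letter \<open>c\<close> the first one, \<open>b\<close>, is still in the base. If
  \<open>c < b\<close>, then \<open>b\<close> stays and \<open>c\<close>, \<open>b\<close>, \<open>a\<close> come out in this order; otherwise
  \<open>c > b > a\<close> expels \<open>b\<close> and the order is \<open>b\<close>, \<open>c\<close>, \<open>a\<close>. Both are occurrences of 231.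
\<close>
lemma no_large_above_large:
  assumes "a < b" "distinct (a # b # xs)"
    and av: "avoids_231 (emit (fold push xs ([b, a], [])))"
  shows "\<forall>x \<in> set xs. x < a"
proof (rule ccontr)
  assume "\<not> ?thesis"
  moreover have "a \<notin> set xs" using assms(2) by simp
  ultimately obtain ys c zs
    where xs: "xs = ys @ c # zs" and ys: "\<forall>y \<in> set ys. y < a" and "a < c"
    using split_at_first_large by blast
  define s where "s = fold push ys ([b, a], [])"
  have "c \<noteq> b" "distinct ys" using assms(2) xs by auto
  have "avoids_231 (emit (fold push zs (push c s)))"
    using av xs by (simp add: s_def)
  then have avc: "avoids_231 (emit (push c s))" by (rule avoids_231_fold_push)
  have "fst s = [b, a] \<or> (\<exists>m < a. fst s = [m, b, a] \<or> (\<exists>y. m < y \<and> y < a \<and> fst s = [y, m, b, a]))"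
  proof (cases ys)
    case Nil
    then show ?thesis by (simp add: s_def)
  next
    case (Cons y ws)
    have "push y ([b, a], []) = ([y, b, a], [])"
      using Cons ys \<open>a < b\<close> by (auto simp: push_Cons)
    moreover have "settled a [b, a] ([y, b, a], [])"
      using Cons ys by (auto simp: settled_def)
    ultimately have "settled a [b, a] s"
      using settled_fold_push[of "[b, a]" a "([y, b, a], [])" ws] Cons ys assms xs
      by (auto simp: s_def emit_def)
    then show ?thesis by (auto simp: settled_def)
  qed
  then obtain T where T: "fst s = T @ [b, a]" and
    "T = [] \<or> (\<exists>m < a. T = [m] \<or> (\<exists>y. m < y \<and> y < a \<and> T = [y, m]))"
    by auto
  note T_cases = this
  obtain out where s_eq: "s = (T @ [b, a], out)" using T by (cases s) auto
  from \<open>c \<noteq> b\<close> consider "c < b" | "b < c" by linarith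
  then show False
  proof cases
    case 1
    then obtain T' out' where push_c: "push c s = (c # T' @ [b, a], out')"
      using T_cases \<open>a < b\<close> \<open>a < c\<close> by (auto simp: s_eq push_Cons)
    have "subseq [c, b, a] (emit (push c s))"
      unfolding push_c emit_def by (auto intro: subseq_drop_many)
    with avoids_231D[OF avc] 1 \<open>a < c\<close> show False by blast
  next
    case 2
    then obtain out' where push_c: "push c s = ([c, a], out' @ [b])"
      using T_cases \<open>a < b\<close> \<open>a < c\<close> by (auto simp: s_eq push_Cons push_Nil)
    have "subseq [b, c, a] (emit (push c s))"
      unfolding push_c emit_def by (auto intro: subseq_drop_many)
    with avoids_231D[OF avc] 2 \<open>a < b\<close> show False by blast
  qed
qed

text \<open>
  After the arrival of \<open>b\<close> only the minimum \<open>k\<close> of the small letters is left below \<open>b\<close>. Every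
  other small letter \<open>e\<close> is in the output already, and \<open>e\<close>, \<open>b\<close>, \<open>k\<close> is a 231.
\<close>
lemma at_most_one_before_large:
  assumes "a < b" "\<forall>x \<in> set (m # xs). x < a" "distinct (m # xs)"
    and av: "avoids_231 (emit (push b (fold push (m # xs) ([a], []))))"
  shows "xs = []"
proof (rule ccontr)
  assume "xs \<noteq> []"
  then obtain z zs where xs: "xs = z # zs" by (cases xs) auto
  define s where "s = fold push (m # xs) ([a], [])"
  have "push m ([a], []) = ([m, a], [])"
    using assms by (simp add: push_Cons)
  moreover have "settled a [a] ([m, a], [])"
    using assms by (simp add: settled_def)
  ultimately have "settled a [a] s"
    using settled_fold_push[of "[a]" a "([m, a], [])" xs] assms by (auto simp: s_def emit_def)
  then obtain k where "k < a" "\<forall>e \<in> set (snd s). k < e"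
    "fst s = [k, a] \<or> (\<exists>y. k < y \<and> y < a \<and> fst s = [y, k, a])"
    by (auto simp: settled_def)
  then obtain out where push_b: "push b s = ([b, k, a], out)" and out: "\<forall>e \<in> set out. k < e"
    using assms(1) by (cases s) (auto simp: push_Cons push_Nil)
  have "{m, z} \<subseteq> set (emit (push b s))"
    using set_emit_fold_push[of "m # xs @ [b]" "([a], [])"] xs by (auto simp: s_def)
  moreover have "m < b" "z < b" "m \<noteq> z" "m \<noteq> a" "z \<noteq> a" using assms xs by auto
  \<comment> \<open>\<open>m\<close> and \<open>z\<close> cannot both be the remaining minimum \<open>k\<close>\<close>
  ultimately obtain e where "e \<in> set out" "e < b"
    unfolding push_b emit_def by auto
  then have "subseq [e, b, k] (emit (push b s))"
    unfolding push_b emit_def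
    using list_emb_append_mono[of "(=)" "[e]" out "[b, k]" "[b, k, a]"]
    by (simp add: subseq_singleton_left)
  with avoids_231D av out \<open>e \<in> set out\<close> \<open>e < b\<close> show False unfolding s_def by blast
qed

text \<open>
  A letter \<open>z > m\<close> arriving next would form a 231 with \<open>b\<close> and \<open>m\<close>, in the stack if \<open>z < b\<close> and
  otherwise with \<open>b\<close> expelled by \<open>z\<close>. So \<open>z < m\<close> and \<open>m\<close> is output. A later large letter \<open>c\<close>
  would be pushed above a minimum \<open>k < m\<close>, and \<open>m\<close>, \<open>c\<close>, \<open>k\<close> would be a 231.
\<close>
lemma after_valley:
  assumes "m < a" "a < b" "distinct (a # m # b # xs)"
    and av: "avoids_231 (emit (fold push xs ([b, m, a], [])))"
  shows "\<forall>x \<in> set xs. x < a" and "xs = [] \<or> hd xs < m"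
proof -
  have "hd xs < m \<and> (\<forall>x \<in> set (tl xs). x < a)" if ne: "xs \<noteq> []"
  proof -
    obtain z zs where xs: "xs = z # zs" using ne by (cases xs) auto
    have "avoids_231 (emit (push z ([b, m, a], [])))"
      using av avoids_231_fold_push xs by auto
    note avz = avoids_231D[OF this]
    have neq: "z \<noteq> m" "z \<noteq> b" "z \<noteq> a" using assms(3) xs by auto
    have "z < m"
    proof (rule ccontr)
      assume "\<not> z < m"
      then consider "m < z" "z < b" | "b < z" using neq by linarith
      then show False
      proof cases
        case 1
        then have "push z ([b, m, a], []) = ([z, b, m, a], [])"
          using assms by (simp add: push_Cons)
        with 1 avz[of z b m] show False by (simp add: emit_def)
      next
        case 2
        then have "push z ([b, m, a], []) = ([z, m, a], [b])"
          using assms by (simp add: push_Cons)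
        with 2 assms avz[of b z m] show False by (simp add: emit_def)
      qed
    qed
    then have push_z: "push z ([b, m, a], []) = ([z, a], [b, m])"
      using assms by (simp add: push_Cons push_Nil)
    have "\<forall>x \<in> set zs. x < a"
    proof (rule ccontr)
      assume "\<not> ?thesis"
      moreover have "a \<notin> set zs" using assms(3) xs by simp
      ultimately obtain us c vs
        where zs: "zs = us @ c # vs" and us: "\<forall>u \<in> set us. u < a" and "a < c"
        using split_at_first_large by blast
      define s where "s = fold push us ([z, a], [b, m])"
      have "avoids_231 (emit (fold push vs (push c s)))"
        using av xs zs push_z by (simp add: s_def)
      then have avc: "avoids_231 (emit (push c s))" by (rule avoids_231_fold_push)
      have "settled a [a] ([z, a], [b, m])"
        using \<open>z < m\<close> assms by (simp add: settled_def)
      then have "settled a [a] s"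
        using settled_fold_push[of "[a]" a "([z, a], [b, m])" us] us assms xs zs
        by (auto simp: s_def emit_def)
      moreover have m: "m \<in> set (snd s)"
        using set_snd_fold_push[of "([z, a], [b, m])" us] by (auto simp: s_def)
      ultimately obtain k where k: "k < m" "k < a"
        "fst s = [k, a] \<or> (\<exists>y. k < y \<and> y < a \<and> fst s = [y, k, a])"
        by (auto simp: settled_def)
      then have "\<exists>out. push c s = ([c, k, a], out) \<and> set (snd s) \<subseteq> set out"
        using \<open>a < c\<close> by (cases s) (auto simp: push_Cons push_Nil)
      then obtain out where push_c: "push c s = ([c, k, a], out)" and "set (snd s) \<subseteq> set out"
        by blast
      with m have "subseq [m, c, k] (emit (push c s))"
        unfolding push_c emit_def
        using list_emb_append_mono[of "(=)" "[m]" out "[c, k]" "[c, k, a]"]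
        by (auto simp: subseq_singleton_left)
      with avoids_231D[OF avc] k assms \<open>a < c\<close> show False by fastforce
    qed
    with \<open>z < m\<close> xs show ?thesis by simp
  qed
  then show "xs = [] \<or> hd xs < m" "\<forall>x \<in> set xs. x < a"
    using assms(1) by (cases xs; force)+
qed

lemma large_letters:
  assumes "distinct (a # xs)" "avoids_231 (stack_map {[1, 2, 3], [3, 2, 1]} (a # xs))"
  obtains
    (none) "\<forall>x \<in> set xs. x < a"
  | (second) b ys where "xs = b # ys" "a < b" "\<forall>y \<in> set ys. y < a"
  | (third) m b ys where "xs = m # b # ys" "m < a" "a < b" "\<forall>y \<in> set ys. y < a"
      "ys = [] \<or> hd ys < m"
proof (cases "\<forall>x \<in> set xs. x < a")
  case True
  then show ?thesis by (rule none)
next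
  case False
  moreover have "a \<notin> set xs" using assms(1) by simp
  ultimately obtain us b ys
    where xs: "xs = us @ b # ys" and us: "\<forall>u \<in> set us. u < a" and "a < b"
    using split_at_first_large by blast
  have av: "avoids_231 (emit (fold push ys (push b (fold push us ([a], [])))))"
    using assms(2) unfolding stack_map_eq_emit xs by (simp add: push_Nil)
  show ?thesis
  proof (cases us)
    case Nil
    have "push b ([a], []) = ([b, a], [])" by (simp add: push_Cons)
    with no_large_above_large[of a b ys] second xs Nil av assms(1) \<open>a < b\<close> show ?thesis by auto
  next
    case (Cons m ws)
    have "ws = []"
      using at_most_one_before_large[of a b m ws] avoids_231_fold_push[OF av] \<open>a < b\<close> us assms(1)
      by (auto simp: Cons xs)
    moreover have "push b (push m ([a], [])) = ([b, m, a], [])"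
      using us Cons \<open>a < b\<close> by (simp add: push_Cons)
    ultimately show ?thesis
      using after_valley[of m a b ys] third[of m b ys] av \<open>a < b\<close> us assms(1) by (auto simp: Cons xs)
  qed
qed

section \<open>Counting the sortable permutations\<close>

lemma mset_postpone: "mset (postpone m xs) = add_mset m (mset xs)"
  by (induction m xs rule: postpone.induct) auto

lemma mset_postpone_minima: "mset (postpone_minima xs) = mset xs"
  by (cases xs) (simp_all add: mset_postpone)

lemma set_postpone_minima: "set (postpone_minima xs) = set xs"
  using mset_postpone_minima mset_eq_setD by blast

lemma distinct_postpone_minima: "distinct (postpone_minima xs) = distinct xs"
  using mset_postpone_minima mset_eq_imp_distinct_iff by blast

lemma postpone_snoc:
  "distinct (m # xs) \<Longrightarrow> \<exists>ys r. postpone m xs = ys @ [r] \<and> r \<le> m \<and> (\<forall>y \<in> set ys. r < y)"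
proof (induction xs arbitrary: m)
  case (Cons x xs)
  show ?case
  proof (cases "m < x")
    case True
    obtain ys r where "postpone m xs = ys @ [r]" "r \<le> m" "\<forall>y \<in> set ys. r < y"
      using Cons.IH[of m] Cons.prems by auto
    with True show ?thesis by (intro exI[of _ "x # ys"] exI[of _ r]) auto
  next
    case False
    obtain ys r where "postpone x xs = ys @ [r]" "r \<le> x" "\<forall>y \<in> set ys. r < y"
      using Cons.IH[of x] Cons.prems by auto
    moreover have "x < m" using False Cons.prems by auto
    ultimately show ?thesis using False by (intro exI[of _ "m # ys"] exI[of _ r]) auto
  qed
qed auto

text \<open>
  An ascent in \<open>xs\<close> would form a 231 with the final minimum.
\<close>
lemma decreasing_if_avoids_231:
  assumes "avoids_231 (xs @ [r])" "\<forall>x \<in> set xs. r < x" "distinct xs"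
  shows "sorted_wrt (>) (xs @ [r])"
proof -
  have "q < p" if pq: "subseq [p, q] xs" for p q
  proof -
    have "subseq [p, q, r] (xs @ [r])" unfolding subseq_triple_snoc_iff using pq by blast
    moreover have "p \<in> set xs" by (rule list_emb_set[OF pq, of p]) auto
    then have "r < p" using assms(2) by blast
    ultimately have "\<not> p < q" using avoids_231D[OF assms(1)] by blast
    moreover have "sorted_wrt (\<noteq>) xs" using assms(3) by (induction xs) auto
    then have "p \<noteq> q" using pq unfolding sorted_wrt_iff_pairs by blast
    ultimately show ?thesis by simp
  qed
  then have "sorted_wrt (>) xs" unfolding sorted_wrt_iff_pairs by blast
  with assms(2) show ?thesis by (simp add: sorted_wrt_append)
qed

text \<open>
  The rearrangement ends with the minimum of \<open>xs\<close>, which is at most the first letter of \<open>xs\<close>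
  and hence also below the prefix \<open>ps\<close>. The prefix is for the letters \<open>b\<close> and \<open>m\<close> that
  precede the rearranged letters in \<open>emit_fold_push_valley\<close>.
\<close>
lemma postpone_minima_decreasing:
  assumes "avoids_231 (ps @ postpone_minima xs)" "distinct (ps @ xs)" "xs \<noteq> []"
    "\<forall>p \<in> set ps. hd xs < p"
  shows "sorted_wrt (>) (ps @ postpone_minima xs)"
proof -
  obtain x zs where xs: "xs = x # zs" using assms(3) by (cases xs) auto
  obtain ys r where pm: "postpone_minima xs = ys @ [r]" and r: "r \<le> x" "\<forall>y \<in> set ys. r < y"
    using postpone_snoc[of x zs] assms(2) xs by auto
  have "distinct (ps @ ys)"
    using assms(2) distinct_postpone_minima[of xs] set_postpone_minima[of xs] pm by auto
  moreover have "\<forall>y \<in> set (ps @ ys). r < y" using r assms(4) xs by auto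
  ultimately show ?thesis using decreasing_if_avoids_231[of "ps @ ys" r] assms(1) pm by simp
qed

text \<open>
  The first two letters of a 231 form an ascent, and the only possible ascents end in the last
  letter.
\<close>
lemma avoids_231_decreasing_snoc:
  assumes "sorted_wrt (>) xs"
  shows "avoids_231 (xs @ [a])"
proof -
  have pq: "q < p" if "subseq [p, q] xs" for p q
    using assms that unfolding sorted_wrt_iff_pairs by blast
  have "avoids_231 xs"
    unfolding avoids_231_def
  proof (intro allI impI)
    fix p q r assume "subseq [p, q, r] xs"
    then have "subseq [p, q] xs"
      using subseq_order.order_trans[of "[p, q]" "[p, q, r]" xs] by simp
    then show "\<not> (r < p \<and> p < q)" using pq[of p q] by simp
  qed
  moreover have "\<not> (a < p \<and> p < q)" if "subseq [p, q] xs" for p q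
    using pq[OF that] by simp
  ultimately show ?thesis
    unfolding avoids_231_def subseq_triple_snoc_iff by blast
qed

lemma avoids_231_decreasing_snoc2:
  assumes "sorted_wrt (>) xs" "\<forall>x \<in> set xs. x < a"
  shows "avoids_231 (xs @ [b, a])"
proof -
  have "\<not> (a < p \<and> p < q)" if "subseq [p, q] (xs @ [b])" for p q
  proof (cases "subseq [p, q] xs")
    case True
    then have "q < p" using assms(1) unfolding sorted_wrt_iff_pairs by blast
    then show ?thesis by simp
  next
    case False
    then have "p \<in> set xs"
      using that unfolding subseq_pair_snoc_iff subseq_singleton_left by blast
    with assms(2) show ?thesis by auto
  qed
  moreover have "avoids_231 (xs @ [b])" using avoids_231_decreasing_snoc assms(1) .
  ultimately have "avoids_231 ((xs @ [b]) @ [a])"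
    unfolding avoids_231_def subseq_triple_snoc_iff by blast
  then show ?thesis by simp
qed

lemma avoids_231_appendD: "avoids_231 (xs @ ys) \<Longrightarrow> avoids_231 xs"
  using avoids_231_subseq subseq_rev_drop_many subseq_order.order_refl by blast

definition decreasing_output :: "nat \<Rightarrow> nat list set" where
  "decreasing_output n = {xs \<in> permutations_of_set {1..n}. sorted_wrt (>) (postpone_minima xs)}"

lemma decreasing_output_iff:
  "xs \<in> decreasing_output n \<longleftrightarrow>
     set xs = {1..n} \<and> distinct xs \<and> sorted_wrt (>) (postpone_minima xs)"
  by (simp add: decreasing_output_def permutations_of_set_def)

lemma finite_decreasing_output: "finite (decreasing_output n)"
  by (simp add: decreasing_output_def)

lemma postpone_minima_max_first:
  "\<forall>x \<in> set xs. x < m \<Longrightarrow> postpone_minima (m # xs) = m # postpone_minima xs"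
  by (cases xs) auto

text \<open>
  For the rearrangement to be decreasing, the maximum \<open>N\<close> must leave first. The letter that
  leaves first is the second one if it exceeds the first one, and the first one otherwise. So
  \<open>N\<close> is first or second, and in both places it does not affect the order in which the other
  letters leave.
\<close>
lemma decreasing_output_Suc:
  fixes n :: nat
  defines "N \<equiv> Suc (Suc n)"
  shows "decreasing_output N =
    (#) N ` decreasing_output (Suc n) \<union>
    (\<lambda>xs. hd xs # N # tl xs) ` decreasing_output (Suc n)" (is "_ = ?A \<union> ?B")
proof (intro equalityI subsetI)
  fix xs assume xs: "xs \<in> decreasing_output N"
  then have set_xs: "set xs = {1..N}" and dist: "distinct xs"
    and dec: "sorted_wrt (>) (postpone_minima xs)"
    by (auto simp: decreasing_output_iff)
  then obtain m ys where m: "xs = m # ys" by (cases xs) (auto simp: N_def)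
  have ys_le: "\<forall>y \<in> set ys. y \<le> N" using set_xs m by auto
  show "xs \<in> ?A \<union> ?B"
  proof (cases "m = N")
    case True
    have "set ys = set xs - {m}" using dist m by simp
    also have "\<dots> = {1..Suc n}" unfolding set_xs True N_def by auto
    finally have "set ys = {1..Suc n}" .
    moreover have "postpone_minima xs = m # postpone_minima ys"
      using postpone_minima_max_first[of ys m] \<open>set ys = {1..Suc n}\<close> True m by (auto simp: N_def)
    ultimately have "ys \<in> decreasing_output (Suc n)"
      using dist dec m by (auto simp: decreasing_output_iff)
    with True m show ?thesis by blast
  next
    case False
    moreover have "m \<in> {1..N}" using set_xs m by auto
    ultimately have "m < N" by simp
    have "N \<in> set xs" using set_xs by (auto simp: N_def)
    then have N_in: "N \<in> set ys" using False m by auto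
    then obtain z zs where z: "ys = z # zs" by (cases ys) auto
    have "m < z"
    proof (rule ccontr)
      assume "\<not> m < z"
      then have "postpone_minima xs = m # postpone_minima ys" using m z by simp
      with dec N_in \<open>m < N\<close> show False by (auto simp: set_postpone_minima)
    qed
    then have pm: "postpone_minima xs = z # postpone_minima (m # zs)" using m z by simp
    have "z = N"
    proof (rule ccontr)
      assume "z \<noteq> N"
      then have "N \<in> set (postpone_minima (m # zs))" "z < N"
        using N_in z ys_le unfolding set_postpone_minima by auto
      with dec pm show False by auto
    qed
    have "set (m # zs) = set xs - {N}" using dist m z \<open>z = N\<close> by auto
    also have "\<dots> = {1..Suc n}" unfolding set_xs N_def by auto
    finally have "set (m # zs) = {1..Suc n}" .
    then have "m # zs \<in> decreasing_output (Suc n)"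
      using dist dec pm m z by (auto simp: decreasing_output_iff)
    then have "hd (m # zs) # N # tl (m # zs) \<in> ?B" by blast
    with m z \<open>z = N\<close> show ?thesis by simp
  qed
next
  fix xs assume "xs \<in> ?A \<union> ?B"
  then obtain ys where ys: "ys \<in> decreasing_output (Suc n)"
    and xs: "xs = N # ys \<or> xs = hd ys # N # tl ys" by blast
  have set_ys: "set ys = {1..Suc n}" and dist: "distinct ys"
    and dec: "sorted_wrt (>) (postpone_minima ys)"
    using ys by (auto simp: decreasing_output_iff)
  have less: "\<forall>y \<in> set ys. y < N" using set_ys by (auto simp: N_def)
  obtain m zs where m: "ys = m # zs" using set_ys by (cases ys) auto
  have "postpone_minima xs = N # postpone_minima ys"
    using xs
  proof
    assume "xs = N # ys"
    then show ?thesis using postpone_minima_max_first less by blast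
  next
    assume "xs = hd ys # N # tl ys"
    then show ?thesis using less m by simp
  qed
  then have "sorted_wrt (>) (postpone_minima xs)"
    using dec less by (simp add: set_postpone_minima)
  moreover have "set xs = insert N (set ys)" "distinct xs"
    using xs dist less m by auto
  moreover have "insert N {1..Suc n} = {1..N}" by (auto simp: N_def)
  ultimately show "xs \<in> decreasing_output N"
    using set_ys by (simp add: decreasing_output_iff)
qed

lemma card_decreasing_output_Suc:
  "card (decreasing_output (Suc (Suc n))) = 2 * card (decreasing_output (Suc n))"
proof -
  let ?D = "decreasing_output (Suc n)" and ?N = "Suc (Suc n)"
  have ne: "xs \<noteq> []" "hd xs \<noteq> ?N" if "xs \<in> ?D" for xs
  proof -
    have "set xs = {1..Suc n}" using that by (simp add: decreasing_output_iff)
    then show "xs \<noteq> []" by auto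
    then have "hd xs \<in> {1..Suc n}" using \<open>set xs = {1..Suc n}\<close> hd_in_set by blast
    then show "hd xs \<noteq> ?N" by auto
  qed
  have "inj_on (\<lambda>xs. hd xs # ?N # tl xs) ?D"
  proof (rule inj_onI)
    fix xs ys assume "xs \<in> ?D" "ys \<in> ?D" "hd xs # ?N # tl xs = hd ys # ?N # tl ys"
    then show "xs = ys" using ne(1)[of xs] ne(1)[of ys] by (simp add: list.expand)
  qed
  then have "card ((\<lambda>xs. hd xs # ?N # tl xs) ` ?D) = card ?D" by (rule card_image)
  moreover have "card ((#) ?N ` ?D) = card ?D" by (simp add: card_image)
  moreover have "(#) ?N ` ?D \<inter> (\<lambda>xs. hd xs # ?N # tl xs) ` ?D = {}"
  proof -
    have "hd ys = ?N" if "ys \<in> (#) ?N ` ?D" for ys using that by auto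
    moreover have "hd ys \<noteq> ?N" if "ys \<in> (\<lambda>xs. hd xs # ?N # tl xs) ` ?D" for ys
      using that ne(2) by auto
    ultimately show ?thesis by blast
  qed
  ultimately show ?thesis
    unfolding decreasing_output_Suc
    by (subst card_Un_disjoint) (simp_all add: finite_decreasing_output)
qed

lemma decreasing_output_0: "decreasing_output 0 = {[]}"
  by (auto simp: decreasing_output_iff)

lemma decreasing_output_1: "decreasing_output (Suc 0) = {[Suc 0]}"
  by (auto simp: decreasing_output_def)

lemma card_decreasing_output: "card (decreasing_output (Suc n)) = 2 ^ n"
  by (induction n) (simp_all add: decreasing_output_1 card_decreasing_output_Suc)

text \<open>
  The values of the leading letters are forced: the letters after them are all smaller, in
  the third case because the rearrangement preceded by \<open>b\<close> and \<open>m\<close> is decreasing.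
\<close>
lemma sortable_iff:
  assumes \<pi>: "\<pi> \<in> permutations_of_set {1..n}" and "1 \<le> n"
  shows "sortable {[1, 2, 3], [3, 2, 1]} \<pi> \<longleftrightarrow>
    (\<exists>xs \<in> decreasing_output (n - 1). \<pi> = n # xs) \<or>
    (2 \<le> n \<and> (\<exists>xs \<in> decreasing_output (n - 2). \<pi> = (n - 1) # n # xs)) \<or>
    (3 \<le> n \<and> (\<exists>xs \<in> decreasing_output (n - 3). \<pi> = (n - 1) # (n - 2) # n # xs))"
    (is "_ \<longleftrightarrow> ?R")
proof -
  have set_\<pi>: "set \<pi> = {1..n}" and dist: "distinct \<pi>"
    using permutations_of_setD[OF \<pi>] by auto
  let ?S = "stack_map {[1, 2, 3], [3, 2, 1]}"
  have "avoids_231 (?S \<pi>) \<longleftrightarrow> ?R"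
  proof
    assume av: "avoids_231 (?S \<pi>)"
    obtain a xs where a: "\<pi> = a # xs" using set_\<pi> \<open>1 \<le> n\<close> by (cases \<pi>) auto
    have le_n: "\<forall>x \<in> set \<pi>. 1 \<le> x \<and> x \<le> n" using set_\<pi> by simp
    have S: "?S \<pi> = emit (fold push xs ([a], []))"
      unfolding stack_map_eq_emit a by (simp add: push_Nil)
    have dist_a: "distinct (a # xs)" using dist a by simp
    from dist_a av[unfolded a] show ?R
    proof (cases rule: large_letters)
      case none
      have "a \<le> n" using le_n a by simp
      moreover have "n \<in> set \<pi>" unfolding set_\<pi> using \<open>1 \<le> n\<close> by simp
      ultimately have "a = n" using none a by force
      have "set xs = set \<pi> - {n}" using dist a \<open>a = n\<close> by auto
      also have "\<dots> = {1..n - 1}" unfolding set_\<pi> by auto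
      finally have set_xs: "set xs = {1..n - 1}" .
      have "?S \<pi> = postpone_minima xs @ [a]"
        unfolding S using emit_fold_push_small[of "[a]" a xs "[]"] none dist_a by simp
      then have "avoids_231 (postpone_minima xs)" using av avoids_231_appendD by metis
      then have "sorted_wrt (>) (postpone_minima xs)"
        using postpone_minima_decreasing[of "[]" xs] dist_a by (cases "xs = []") auto
      then have "xs \<in> decreasing_output (n - 1)"
        using set_xs dist_a by (simp add: decreasing_output_iff)
      with a \<open>a = n\<close> show ?R by blast
    next
      case (second b ys)
      have "1 \<le> a" "b \<le> n" using le_n a second by auto
      with second have "2 \<le> n" by simp
      then have "n \<in> set \<pi>" "n - 1 \<in> set \<pi>" unfolding set_\<pi> by auto
      then have mem: "n \<in> {a, b} \<union> set ys" "n - 1 \<in> {a, b} \<union> set ys" using a second by auto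
      have "b = n" using mem(1) second \<open>b \<le> n\<close> by force
      have "a = n - 1" using mem(2) second \<open>b = n\<close> \<open>2 \<le> n\<close> by force
      have "set ys = set \<pi> - {n, n - 1}" using dist a second \<open>a = n - 1\<close> \<open>b = n\<close> by auto
      also have "\<dots> = {1..n - 2}" unfolding set_\<pi> by auto
      finally have set_ys: "set ys = {1..n - 2}" .
      have "push b ([a], []) = ([b, a], [])" by (simp add: push_Cons)
      then have "?S \<pi> = postpone_minima ys @ [b, a]"
        unfolding S using emit_fold_push_small[of "[b, a]" a ys "[]"] second dist_a by simp
      then have "avoids_231 (postpone_minima ys)" using av avoids_231_appendD by metis
      then have "sorted_wrt (>) (postpone_minima ys)"
        using postpone_minima_decreasing[of "[]" ys] dist_a second by (cases "ys = []") auto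
      then have "ys \<in> decreasing_output (n - 2)"
        using set_ys dist_a second by (simp add: decreasing_output_iff)
      with a second \<open>a = n - 1\<close> \<open>b = n\<close> \<open>2 \<le> n\<close> show ?R by blast
    next
      case (third m b ys)
      have "push b (push m ([a], [])) = ([b, m, a], [])"
        using third by (simp add: push_Cons)
      then have "?S \<pi> = ([b, m] @ postpone_minima ys) @ [a]"
        unfolding S using emit_fold_push_valley[of m a b ys] third dist_a by simp
      then have "avoids_231 ([b, m] @ postpone_minima ys)" using av avoids_231_appendD by metis
      moreover have "\<forall>p \<in> set [b, m]. hd ys < p" if "ys \<noteq> []" using third that by auto
      ultimately have dec: "sorted_wrt (>) ([b, m] @ postpone_minima ys)"
        using postpone_minima_decreasing[of "[b, m]" ys] dist_a third by (cases "ys = []") auto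
      then have less: "\<forall>y \<in> set ys. y < m" by (simp add: set_postpone_minima)
      have "1 \<le> m" "b \<le> n" using le_n a third by auto
      with third have ge: "3 \<le> n" by simp
      then have "n \<in> set \<pi>" "n - 1 \<in> set \<pi>" "n - 2 \<in> set \<pi>" unfolding set_\<pi> by auto
      then have mem: "n \<in> {a, m, b} \<union> set ys" "n - 1 \<in> {a, m, b} \<union> set ys"
          "n - 2 \<in> {a, m, b} \<union> set ys"
        using a third by auto
      have "b = n" using mem(1) third \<open>b \<le> n\<close> less by force
      have "a = n - 1" using mem(2) third less \<open>b = n\<close> ge by force
      have "m = n - 2" using mem(3) third less \<open>b = n\<close> \<open>a = n - 1\<close> ge by force
      have "set ys = set \<pi> - {n, n - 1, n - 2}"
        using dist a third \<open>a = n - 1\<close> \<open>b = n\<close> \<open>m = n - 2\<close> by auto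
      also have "\<dots> = {1..n - 3}" unfolding set_\<pi> by auto
      finally have set_ys: "set ys = {1..n - 3}" .
      then have "ys \<in> decreasing_output (n - 3)"
        using dec dist_a third by (simp add: decreasing_output_iff)
      with a third \<open>a = n - 1\<close> \<open>b = n\<close> \<open>m = n - 2\<close> ge show ?R by blast
    qed
  next
    assume ?R
    then consider (none) xs where "xs \<in> decreasing_output (n - 1)" "\<pi> = n # xs"
      | (second) xs where "2 \<le> n" "xs \<in> decreasing_output (n - 2)" "\<pi> = (n - 1) # n # xs"
      | (third) xs where "3 \<le> n" "xs \<in> decreasing_output (n - 3)"
          "\<pi> = (n - 1) # (n - 2) # n # xs"
      by blast
    then show "avoids_231 (?S \<pi>)"
    proof cases
      case none
      then have xs: "\<forall>x \<in> set xs. x < n" "distinct xs" "sorted_wrt (>) (postpone_minima xs)"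
        using \<open>1 \<le> n\<close> by (auto simp: decreasing_output_iff)
      have "?S \<pi> = emit (fold push xs ([n], []))"
        unfolding stack_map_eq_emit none by (simp add: push_Nil)
      also have "\<dots> = postpone_minima xs @ [n]"
        using emit_fold_push_small[of "[n]" n xs "[]"] xs by simp
      finally show ?thesis using avoids_231_decreasing_snoc xs(3) by simp
    next
      case second
      then have xs: "\<forall>x \<in> set xs. x < n - 1" "distinct xs" "sorted_wrt (>) (postpone_minima xs)"
        by (auto simp: decreasing_output_iff)
      have "?S \<pi> = emit (fold push xs ([n, n - 1], []))"
        unfolding stack_map_eq_emit second by (simp add: push_Nil push_Cons)
      also have "\<dots> = postpone_minima xs @ [n, n - 1]"
        using emit_fold_push_small[of "[n, n - 1]" "n - 1" xs "[]"] xs second(1) by simp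
      finally show ?thesis
        using avoids_231_decreasing_snoc2 xs by (simp add: set_postpone_minima)
    next
      case third
      then have xs: "\<forall>x \<in> set xs. x < n - 2" "distinct xs" "sorted_wrt (>) (postpone_minima xs)"
        by (auto simp: decreasing_output_iff)
      have "push n (push (n - 2) (push (n - 1) ([], []))) = ([n, n - 2, n - 1], [])"
        using third(1) by (auto simp: push_Nil push_Cons)
      then have "?S \<pi> = emit (fold push xs ([n, n - 2, n - 1], []))"
        unfolding stack_map_eq_emit third by simp
      also have "\<dots> = (n # (n - 2) # postpone_minima xs) @ [n - 1]"
      proof -
        have "n - 2 < n - 1" "n - 1 < n" using third(1) by auto
        moreover have "\<forall>x \<in> set xs. x < n - 1" using xs(1) by auto
        moreover have "xs = [] \<or> hd xs < n - 2" using xs(1) hd_in_set by blast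
        ultimately show ?thesis using emit_fold_push_valley xs(2) by simp
      qed
      also have "avoids_231 \<dots>"
      proof (rule avoids_231_decreasing_snoc)
        show "sorted_wrt (>) (n # (n - 2) # postpone_minima xs)"
          using xs(1,3) third(1) by (auto simp: set_postpone_minima)
      qed
      finally show ?thesis .
    qed
  qed
  with sortable_iff_avoids_231[OF \<pi>] show ?thesis by simp
qed

lemma num_sortable_eq:
  assumes "1 \<le> n"
  shows "num_sortable {[1, 2, 3], [3, 2, 1]} n =
    card (decreasing_output (n - 1)) +
    (if 2 \<le> n then card (decreasing_output (n - 2)) else 0) +
    (if 3 \<le> n then card (decreasing_output (n - 3)) else 0)"
proof -
  define A where "A = (#) n ` decreasing_output (n - 1)"
  define B where "B = (if 2 \<le> n then (\<lambda>xs. (n - 1) # n # xs) ` decreasing_output (n - 2) else {})"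
  define C where
    "C = (if 3 \<le> n then (\<lambda>xs. (n - 1) # (n - 2) # n # xs) ` decreasing_output (n - 3) else {})"
  have "A \<union> B \<union> C \<subseteq> permutations_of_set {1..n}"
    using assms unfolding A_def B_def C_def permutations_of_set_def
    by (auto simp: decreasing_output_iff)
  then have "{\<pi> \<in> permutations_of_set {1..n}. sortable {[1, 2, 3], [3, 2, 1]} \<pi>} = A \<union> B \<union> C"
    using sortable_iff[OF _ assms] by (auto simp: A_def B_def C_def split: if_splits)
  moreover have "finite A" "finite B" "finite C"
    by (simp_all add: A_def B_def C_def finite_decreasing_output)
  moreover have "A \<inter> B = {}" "(A \<union> B) \<inter> C = {}"
    using assms by (auto simp: A_def B_def C_def)
  ultimately have "num_sortable {[1, 2, 3], [3, 2, 1]} n = card A + card B + card C"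
    unfolding num_sortable_def by (simp add: card_Un_disjoint)
  moreover have "card A = card (decreasing_output (n - 1))"
    by (simp add: A_def card_image)
  moreover have "card B = (if 2 \<le> n then card (decreasing_output (n - 2)) else 0)"
    by (simp add: B_def card_image inj_on_def)
  moreover have "card C = (if 3 \<le> n then card (decreasing_output (n - 3)) else 0)"
    by (simp add: C_def card_image inj_on_def)
  ultimately show ?thesis by simp
qed

theorem theorem6p7:
  fixes f :: "nat \<Rightarrow> nat"
  defines "f \<equiv> num_sortable {[1, 2, 3], [3, 2, 1]}"
  shows "f 1 = 1 \<and> f 2 = 2 \<and> f 3 = 4 \<and> (\<forall>n\<ge>4. f n = 7 * 2 ^ (n - 4))"
proof (intro conjI allI impI)
  show "f 1 = 1" unfolding f_def num_sortable_eq[OF order.refl] by (simp add: decreasing_output_0)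
  show "f 2 = 2" unfolding f_def
    by (subst num_sortable_eq) (simp_all add: decreasing_output_0 decreasing_output_1)
  show "f 3 = 4" unfolding f_def
    using card_decreasing_output[of 1]
    by (subst num_sortable_eq) (simp_all add: decreasing_output_0 decreasing_output_1 numeral_2_eq_2)
  fix n :: nat assume "4 \<le> n"
  then obtain k where "n = 4 + k" using le_Suc_ex by blast
  then have "n - 1 = Suc (k + 2)" "n - 2 = Suc (k + 1)" "n - 3 = Suc k" "n - 4 = k" by simp_all
  with \<open>4 \<le> n\<close> show "f n = 7 * 2 ^ (n - 4)"
    unfolding f_def by (subst num_sortable_eq) (simp_all add: card_decreasing_output)
qed

end
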